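(* Let $n\ge 1$ and let $s=a_1a_2\cdots a_n$ be a permutation of $[n]$ in one-line form. Then $$td(s)\geq \max_{\gamma}\left\{\frac{\max\{|C(p_t\bar{s}\gamma)-C(\gamma)|,\ |C_{odd}(p_t\bar{s}\gamma)-C_{odd}(\gamma)|,\ |C_{ev}(p_t\bar{s}\gamma)-C_{ev}(\gamma)|\}}{2}\right\},$$ where $\gamma$ ranges over all permutations of $[n]^*=\{0,1,\dots,n\}$.
   Context: $[n]=\{1,\dots,n\}$. A transposition action on a sequence $s=a_1\cdots a_n$ swaps two adjacent blocks: for some $1\le i\le j<k\le n$ it changes $a_1\cdots a_{i-1}\,a_i\cdots a_j\,a_{j+1}\cdots a_k\,a_{k+1}\cdots a_n$ into $a_1\cdots a_{i-1}\,a_{j+1}\cdots a_k\,a_i\cdots a_j\,a_{k+1}\cdots a_n$. The transposition distance $td(s)$ is the minimum number of such actions needed to transform $s$ into $e_n=12\cdots n$. In cycle notation on $[n]^*$, $\bar s=(0~a_1~a_2~\cdots~a_n)$ and $p_t=(n~n-1~\cdots~1~0)$. For a permutation $\pi$, $C(\pi)$, $C_{odd}(\pi)$, $C_{ev}(\pi)$ denote the number of cycles, of cycles of odd length, and of cycles of even length of $\pi$ (fixed points are cycles of length 1). Products of permutations are compositions of maps (right to left). *)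

theory Defs
  imports
    Complex_Main
    "HOL-Combinatorics.Cycles"
    "HOL-Combinatorics.Orbits"
    "HOL-Combinatorics.Multiset_Permutations"
begin

text \<open>
  A sequence is a list; \<open>us\<close> and \<open>vs\<close> may be empty, the two swapped blocks may not.
\<close>

definition transposition_action :: "'a list \<Rightarrow> 'a list \<Rightarrow> bool" where
  "transposition_action s t \<longleftrightarrow>
     (\<exists>us xs ys vs. xs \<noteq> [] \<and> ys \<noteq> [] \<and> s = us @ xs @ ys @ vs \<and> t = us @ ys @ xs @ vs)"

definition identity_seq :: "nat \<Rightarrow> nat list" where
  "identity_seq n = [1..<Suc n]"

definition td :: "nat list \<Rightarrow> nat" where
  "td s = (LEAST k. (transposition_action ^^ k) s (identity_seq (length s)))"

text \<open>
  In \<^const>\<open>cycle_of_list\<close> each entry is mapped to the next one and the last to the first.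
  Everything outside the list is fixed, so these maps permute \<open>{0..n}\<close>.
\<close>

definition sbar :: "nat list \<Rightarrow> nat \<Rightarrow> nat" where
  "sbar s = cycle_of_list (0 # s)"

definition p_t :: "nat \<Rightarrow> nat \<Rightarrow> nat" where
  "p_t n = cycle_of_list (rev [0..<Suc n])"

text \<open>
  Permutations of \<open>A\<close> are total functions fixing everything outside \<open>A\<close>. Therefore only the
  orbits of points of \<open>A\<close> are counted, which include the singleton orbits of fixed points in \<open>A\<close>.
\<close>

definition cycles_on :: "'a set \<Rightarrow> ('a \<Rightarrow> 'a) \<Rightarrow> 'a set set" where
  "cycles_on A \<pi> = orbit \<pi> ` A"

definition C :: "'a set \<Rightarrow> ('a \<Rightarrow> 'a) \<Rightarrow> nat" where
  "C A \<pi> = card (cycles_on A \<pi>)"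

definition C_odd :: "'a set \<Rightarrow> ('a \<Rightarrow> 'a) \<Rightarrow> nat" where
  "C_odd A \<pi> = card {c \<in> cycles_on A \<pi>. odd (card c)}"

definition C_ev :: "'a set \<Rightarrow> ('a \<Rightarrow> 'a) \<Rightarrow> nat" where
  "C_ev A \<pi> = card {c \<in> cycles_on A \<pi>. even (card c)}"

text \<open>The set over which \<^const>\<open>td\<close> minimises is nonempty for permutations of \<open>{1..n}\<close>.\<close>

lemma transposition_action_Cons:
  assumes "transposition_action s t"
  shows "transposition_action (a # s) (a # t)"
proof -
  from assms obtain us xs ys vs where *: "xs \<noteq> []" "ys \<noteq> []"
    "s = us @ xs @ ys @ vs" "t = us @ ys @ xs @ vs"
    unfolding transposition_action_def by blast
  show ?thesis
    unfolding transposition_action_def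
    by (rule exI[of _ "a # us"], rule exI[of _ xs], rule exI[of _ ys], rule exI[of _ vs])
      (simp add: *)
qed

lemma transposition_action_reachable:
  assumes "mset s = mset t"
  shows "transposition_action\<^sup>*\<^sup>* s t"
  using assms
proof (induction t arbitrary: s)
  case Nil
  then show ?case by simp
next
  case (Cons a t)
  then have "a \<in> set s"
    using mset_eq_setD[OF Cons.prems] by simp
  then obtain us vs where s: "s = us @ a # vs"
    by (meson split_list)
  have front: "transposition_action\<^sup>*\<^sup>* s (a # us @ vs)"
  proof (cases "us = []")
    case False
    have "transposition_action s (a # us @ vs)"
      unfolding transposition_action_def s
      by (rule exI[of _ "[]"], rule exI[of _ us], rule exI[of _ "[a]"], rule exI[of _ vs])
        (use False in simp)
    then show ?thesis by blast
  qed (simp add: s)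
  have "mset (us @ vs) = mset t"
    using Cons.prems s by simp
  then have "transposition_action\<^sup>*\<^sup>* (us @ vs) t"
    by (rule Cons.IH)
  then have "transposition_action\<^sup>*\<^sup>* (a # us @ vs) (a # t)"
  proof (induction rule: rtranclp_induct)
    case (step y z)
    from step.IH transposition_action_Cons[OF step.hyps(2)] show ?case
      by (rule rtranclp.rtrancl_into_rtrancl)
  qed (rule rtranclp.rtrancl_refl)
  with front show ?case by (rule rtranclp_trans)
qed

lemma td_attained:
  assumes "s \<in> permutations_of_set {1..n}"
  shows "(transposition_action ^^ td s) s (identity_seq n)"
proof -
  have len: "length s = n"
    using length_finite_permutations_of_set[OF assms] by simp
  have "set s = set (identity_seq n)"
    using permutations_of_setD(1)[OF assms] unfolding identity_seq_def set_upt
    by (simp only: atLeastLessThanSuc_atLeastAtMost)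
  moreover have "distinct (identity_seq n)"
    unfolding identity_seq_def by (rule distinct_upt)
  ultimately have "mset s = mset (identity_seq n)"
    using permutations_of_setD(2)[OF assms] set_eq_iff_mset_eq_distinct by metis
  then have "\<exists>k. (transposition_action ^^ k) s (identity_seq (length s))"
    unfolding len by (intro rtranclp_imp_relpowp transposition_action_reachable)
  from LeastI_ex[OF this] show ?thesis
    by (simp add: td_def len)
qed

end

theory Submission
  imports Defs
begin

text \<open>
  A transposition action that turns \<open>s\<close> into \<open>t\<close> gives \<open>sbar s = sbar t \<circ> \<kappa>\<close> for a 3-cycle
  \<open>\<kappa>\<close>, and \<open>p_t n\<close> is the inverse of \<open>sbar\<close> of the identity sequence. Along a shortest sorting,
  \<open>p_t n \<circ> sbar s\<close> thus becomes a product of \<open>td s\<close> 3-cycles, and it suffices that left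
  multiplication by one 3-cycle \<open>(a b c)\<close> changes each cycle count by at most 2. Only the cycles
  through \<open>a\<close>, \<open>b\<close>, \<open>c\<close> are affected, at most three of them. If there are three, they
  are merged into one cycle, which is odd (even) if all three are odd (even). Hence the count
  never drops by 3, and the inverse 3-cycle gives the bound in the other direction.
\<close>

section \<open>Cycles given by lists\<close>

lemma cycle_of_list_permutes_superset:
  "set cs \<subseteq> A \<Longrightarrow> cycle_of_list cs permutes A"
  by (rule permutes_subset[OF cycle_permutes])

text \<open>A list cycle is the product of the transpositions of consecutive entries, so it can be
  cut at any entry \<open>y\<close>, which both factors keep.\<close>

lemma cycle_of_list_append:
  "cycle_of_list (xs @ y # ys) = cycle_of_list (xs @ [y]) \<circ> cycle_of_list (y # ys)"
proof (induction xs)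
  case (Cons x xs)
  then show ?case
    by (cases xs) (simp_all add: comp_assoc)
qed simp

text \<open>The reversed list gives the same transpositions in opposite order; each is an
  involution, so the product telescopes.\<close>

lemma cycle_of_list_rev_comp: "cycle_of_list (rev cs) \<circ> cycle_of_list cs = id"
proof (induction cs rule: cycle_of_list.induct)
  case (1 i j cs)
  have "cycle_of_list (rev (i # j # cs)) = cycle_of_list (rev (j # cs)) \<circ> transpose i j"
    using cycle_of_list_append[of "rev cs" j "[i]"] by (simp add: transpose_commute)
  then have "cycle_of_list (rev (i # j # cs)) \<circ> cycle_of_list (i # j # cs) =
      cycle_of_list (rev (j # cs)) \<circ> (transpose i j \<circ> transpose i j) \<circ> cycle_of_list (j # cs)"
    by (simp only: cycle_of_list.simps comp_assoc)
  also have "\<dots> = id"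
    using 1 by (simp only: transpose_comp_involutory comp_id)
  finally show ?case .
qed simp_all

text \<open>Rotating \<open>a\<close> to the end turns the link to \<open>a\<close> into the last
  transposition, which splits off on the right.\<close>

lemma cycle_of_list_Cons_snoc:
  assumes "distinct (a # xs @ [b])"
  shows "cycle_of_list (a # xs @ [b]) = cycle_of_list (xs @ [b]) \<circ> transpose b a"
proof -
  have "cycle_of_list (a # xs @ [b]) = cycle_of_list (xs @ [b, a])"
    using cycle_of_list_rotate_independent[OF assms, of 1] by simp
  then show ?thesis
    using cycle_of_list_append[of xs b "[a]"] by simp
qed

lemma cycle_of_list_commute:
  assumes "set xs \<inter> set ys = {}"
  shows "cycle_of_list xs \<circ> cycle_of_list ys = cycle_of_list ys \<circ> cycle_of_list xs"
proof
  fix x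
  have disjoint: "y \<in> set xs \<Longrightarrow> y \<notin> set ys" "y \<in> set ys \<Longrightarrow> y \<notin> set xs" for y
    using assms by auto
  show "(cycle_of_list xs \<circ> cycle_of_list ys) x = (cycle_of_list ys \<circ> cycle_of_list xs) x"
    using permutes_in_image[OF cycle_permutes[of xs], of x]
      permutes_in_image[OF cycle_permutes[of ys], of x]
    by (cases "x \<in> set xs"; cases "x \<in> set ys") (simp_all add: id_outside_supp disjoint)
qed

text \<open>Cutting at \<open>u\<close> and \<open>x\<close> leaves overlapping cycles; splitting
  off each shared entry and moving \<open>transpose x u\<close> past the disjoint last cycle
  collects all links between blocks on the right.\<close>

lemma cycle_of_list_three_blocks:
  assumes "distinct (us @ [u] @ xs @ [x] @ ys @ [y])"
  shows "cycle_of_list (us @ [u] @ xs @ [x] @ ys @ [y]) =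
    cycle_of_list (us @ [u]) \<circ> (cycle_of_list (xs @ [x]) \<circ> cycle_of_list (ys @ [y])) \<circ>
      (transpose x u \<circ> transpose y x)"
proof -
  have "cycle_of_list (us @ [u] @ xs @ [x] @ ys @ [y]) =
      cycle_of_list (us @ [u]) \<circ> (cycle_of_list (u # xs @ [x]) \<circ> cycle_of_list (x # ys @ [y]))"
    using cycle_of_list_append[of us u "xs @ [x] @ ys @ [y]"]
      cycle_of_list_append[of "u # xs" x "ys @ [y]"] by simp
  also have "cycle_of_list (u # xs @ [x]) = cycle_of_list (xs @ [x]) \<circ> transpose x u"
    using assms by (intro cycle_of_list_Cons_snoc) auto
  also have "cycle_of_list (x # ys @ [y]) = cycle_of_list (ys @ [y]) \<circ> transpose y x"
    using assms by (intro cycle_of_list_Cons_snoc) auto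
  also have "cycle_of_list (us @ [u]) \<circ> (cycle_of_list (xs @ [x]) \<circ> transpose x u \<circ>
        (cycle_of_list (ys @ [y]) \<circ> transpose y x)) =
      cycle_of_list (us @ [u]) \<circ> (cycle_of_list (xs @ [x]) \<circ>
        (transpose x u \<circ> cycle_of_list (ys @ [y])) \<circ> transpose y x)"
    by (simp only: comp_assoc)
  also have "transpose x u \<circ> cycle_of_list (ys @ [y]) = cycle_of_list (ys @ [y]) \<circ> transpose x u"
    using assms cycle_of_list_commute[of "[x, u]" "ys @ [y]"] by auto
  finally show ?thesis
    by (simp only: comp_assoc)
qed

text \<open>The block cycles commute, so the factorisations for the two block orders differ only in
  the trailing transpositions.\<close>

lemma cycle_of_list_swap_blocks:
  assumes "distinct (us @ [u] @ xs @ [x] @ ys @ [y])"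
  shows "cycle_of_list (us @ [u] @ xs @ [x] @ ys @ [y]) =
    cycle_of_list (us @ [u] @ ys @ [y] @ xs @ [x]) \<circ> cycle_of_list [u, y, x]"
proof -
  have "cycle_of_list (us @ [u] @ ys @ [y] @ xs @ [x]) =
    cycle_of_list (us @ [u]) \<circ> (cycle_of_list (ys @ [y]) \<circ> cycle_of_list (xs @ [x])) \<circ>
      (transpose y u \<circ> transpose x y)"
    using assms by (intro cycle_of_list_three_blocks) auto
  moreover have "cycle_of_list (ys @ [y]) \<circ> cycle_of_list (xs @ [x]) =
      cycle_of_list (xs @ [x]) \<circ> cycle_of_list (ys @ [y])"
    using assms by (intro cycle_of_list_commute) auto
  \<comment> \<open>The left side is the cycle (u x y); on the right, both the product of
    transpositions and the last factor are (u y x), whose square is its inverse.\<close>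
  moreover have "transpose x u \<circ> transpose y x =
      transpose y u \<circ> transpose x y \<circ> cycle_of_list [u, y, x]"
    using assms by (auto simp: fun_eq_iff transpose_def)
  ultimately show ?thesis
    using cycle_of_list_three_blocks[OF assms] by (simp only: comp_assoc)
qed

section \<open>Effect of a transposition action on \<open>sbar\<close>\<close>

lemma transposition_action_mset: "transposition_action s t \<Longrightarrow> mset s = mset t"
  by (auto simp: transposition_action_def)

text \<open>Read cyclically, the parts outside the swapped blocks form a third block, nonempty
  because it contains 0. The 3-cycle consists of the last entries of the three blocks.\<close>

lemma sbar_transposition_action:
  assumes "transposition_action s t" "distinct (0 # s)"
  obtains a b c where "distinct [a, b, c]" "{a, b, c} \<subseteq> insert 0 (set s)"
    "sbar s = sbar t \<circ> cycle_of_list [a, b, c]"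
proof -
  obtain us xs ys vs where ne: "xs \<noteq> []" "ys \<noteq> []"
    and s: "s = us @ xs @ ys @ vs" and t: "t = us @ ys @ xs @ vs"
    using assms(1) unfolding transposition_action_def by blast
  obtain xs' x where xs: "xs = xs' @ [x]" using ne by (metis rev_exhaust)
  obtain ys' y where ys: "ys = ys' @ [y]" using ne by (metis rev_exhaust)
  \<comment> \<open>Rotating \<open>vs\<close> to the front makes the two swapped blocks the tail of the list.\<close>
  obtain us' u where us: "vs @ 0 # us = us' @ [u]"
    by (metis rev_exhaust Nil_is_append_conv list.distinct(1))
  have rot: "cycle_of_list (0 # us @ zs @ vs) = cycle_of_list (us' @ [u] @ zs)"
    if "distinct (0 # us @ zs @ vs)" for zs
    using cycle_of_list_rotate_independent[OF that, of "length (0 # us @ zs)"]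
      rotate_append[of "0 # us @ zs" vs] us
    by (metis append.assoc append_Cons)
  have "distinct (vs @ 0 # us @ xs @ ys)"
    using assms(2) s by auto
  then have d: "distinct (us' @ [u] @ xs' @ [x] @ ys' @ [y])"
    using us xs ys by (metis append.assoc append_Cons)
  have "sbar s = cycle_of_list (us' @ [u] @ xs' @ [x] @ ys' @ [y])"
    using rot[of "xs @ ys"] assms(2) by (simp add: sbar_def s xs ys)
  moreover have "sbar t = cycle_of_list (us' @ [u] @ ys' @ [y] @ xs' @ [x])"
    using rot[of "ys @ xs"] assms(2) by (auto simp: sbar_def t s xs ys)
  ultimately have "sbar s = sbar t \<circ> cycle_of_list [u, y, x]"
    using cycle_of_list_swap_blocks[OF d] by simp
  moreover have "u \<in> set (vs @ 0 # us)"
    unfolding us by simp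
  then have "{u, y, x} \<subseteq> insert 0 (set s)"
    by (auto simp: s xs ys)
  moreover have "distinct [u, y, x]"
    using d by auto
  ultimately show ?thesis
    using that by blast
qed

lemma p_t_comp_sbar_identity_seq: "p_t n \<circ> sbar (identity_seq n) = id"
proof -
  have "0 # identity_seq n = [0..<Suc n]"
    unfolding identity_seq_def by (simp add: upt_conv_Cons del: upt_Suc)
  then show ?thesis
    unfolding p_t_def sbar_def using cycle_of_list_rev_comp[of "[0..<Suc n]"] by (simp only:)
qed

section \<open>Cycle counts under multiplication by a 3-cycle\<close>

text \<open>Taking \<open>P\<close> constantly true, \<open>odd\<close> or \<open>even\<close> gives
  \<open>C\<close>, \<open>C_odd\<close> or \<open>C_ev\<close>, so one argument serves all
  three.\<close>

definition cycle_count :: "(nat \<Rightarrow> bool) \<Rightarrow> 'a set \<Rightarrow> ('a \<Rightarrow> 'a) \<Rightarrow> nat" where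
  "cycle_count P A \<pi> = card {c \<in> cycles_on A \<pi>. P (card c)}"

text \<open>Started at \<open>a\<close>, the map \<open>g \<circ> f\<close> follows \<open>f\<close>
  until \<open>f\<close> would return to \<open>a\<close>; there it reaches
  \<open>g a\<close>.\<close>

lemma orbit_comp_fixing:
  assumes self: "a \<in> orbit f a"
    and fixed: "\<And>x. x \<in> orbit f a \<Longrightarrow> x \<noteq> a \<Longrightarrow> g x = x"
  shows "g a \<in> orbit (g \<circ> f) a"
proof -
  have collapse: "(if f y = a then g a else f y) = (g \<circ> f) y" if "f y \<in> orbit f a" for y
    using fixed[OF that] by auto
  \<comment> \<open>The induction needs a claim about every orbit point, with \<open>g a\<close> in
    place of \<open>a\<close>; the goal is the instance \<open>x = a\<close>.\<close>
  have "(if x = a then g a else x) \<in> orbit (g \<circ> f) a" if "x \<in> orbit f a" for x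
    using that
  proof induction
    case base
    show ?case
      unfolding collapse[OF orbit.base] by (rule orbit.base)
  next
    case (step y)
    have "(g \<circ> f) y \<in> orbit (g \<circ> f) a"
      using step.IH orbit.base[of "g \<circ> f" a] orbit.step[of y "g \<circ> f" a]
      by (cases "y = a") (simp_all del: comp_apply)
    then show ?case
      unfolding collapse[OF orbit.step[OF step.hyps]] .
  qed
  from this[OF self] show ?thesis
    by simp
qed

section \<open>Cycles meeting and cycles avoiding a set \<open>T\<close>\<close>

context
  fixes A :: "'a set" and \<pi> :: "'a \<Rightarrow> 'a"
  assumes fin: "finite A" and perm: "\<pi> permutes A"
begin

lemma self_in_orbit: "x \<in> orbit \<pi> x"
  using fin perm by (intro permutation_self_in_orbit) (auto simp: permutation_permutes)

lemma orbit_eq: "y \<in> orbit \<pi> x \<Longrightarrow> orbit \<pi> y = orbit \<pi> x"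
  using orbit_cyclic_eq3[OF cyclic_on_orbit[OF perm fin]] by blast

lemma orbit_subset_ground: "x \<in> A \<Longrightarrow> orbit \<pi> x \<subseteq> A"
  by (rule permutes_orbit_subset[OF perm])

lemma finite_cycles_on: "finite (cycles_on A \<pi>)"
  unfolding cycles_on_def using fin by simp

text \<open>The right side depends only on the cycles avoiding \<open>T\<close>. Multiplication by a
  permutation of \<open>T\<close> preserves these, hence also the union on the left.\<close>

lemma Union_cycles_meeting:
  assumes "T \<subseteq> A"
  shows "\<Union>(orbit \<pi> ` T) = A - \<Union>{X \<in> cycles_on A \<pi>. X \<inter> T = {}}"
proof
  show "\<Union>(orbit \<pi> ` T) \<subseteq> A - \<Union>{X \<in> cycles_on A \<pi>. X \<inter> T = {}}"
  proof clarify
    fix x t assume t: "t \<in> T" "x \<in> orbit \<pi> t"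
    have "x \<notin> orbit \<pi> y" if "orbit \<pi> y \<inter> T = {}" for y
      using orbit_eq[OF t(2)] orbit_eq[of x y] self_in_orbit[of t] t(1) that by auto
    then show "x \<in> A - \<Union>{X \<in> cycles_on A \<pi>. X \<inter> T = {}}"
      using orbit_subset_ground t assms by (auto simp: cycles_on_def)
  qed
  show "A - \<Union>{X \<in> cycles_on A \<pi>. X \<inter> T = {}} \<subseteq> \<Union>(orbit \<pi> ` T)"
  proof
    fix x assume x: "x \<in> A - \<Union>{X \<in> cycles_on A \<pi>. X \<inter> T = {}}"
    then have "orbit \<pi> x \<inter> T \<noteq> {}"
      using self_in_orbit[of x] by (auto simp: cycles_on_def)
    then obtain t where "t \<in> T" "t \<in> orbit \<pi> x"
      by blast
    then show "x \<in> \<Union>(orbit \<pi> ` T)"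
      using orbit_eq[of t x] self_in_orbit[of x] by auto
  qed
qed

lemma cycle_count_split:
  assumes "T \<subseteq> A"
  shows "cycle_count P A \<pi> = card {X \<in> orbit \<pi> ` T. P (card X)} +
    card {X \<in> cycles_on A \<pi>. X \<inter> T = {} \<and> P (card X)}"
proof -
  have "{X \<in> cycles_on A \<pi>. P (card X)} =
      {X \<in> orbit \<pi> ` T. P (card X)} \<union> {X \<in> cycles_on A \<pi>. X \<inter> T = {} \<and> P (card X)}"
  proof -
    have "X \<in> orbit \<pi> ` T" if "X \<in> cycles_on A \<pi>" "X \<inter> T \<noteq> {}" for X
      using that orbit_eq by (fastforce simp: cycles_on_def)
    then show ?thesis
      using assms by (auto simp: cycles_on_def)
  qed
  moreover have "finite T"
    using assms fin finite_subset by blast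
  moreover have "X \<inter> T \<noteq> {}" if "X \<in> orbit \<pi> ` T" for X
    using that self_in_orbit by auto
  ultimately show ?thesis
    unfolding cycle_count_def using finite_cycles_on
    by (subst card_Un_disjoint[symmetric]) auto
qed

text \<open>Composing with \<open>\<kappa>\<close> changes \<open>\<pi>\<close> only at points
  mapped into \<open>T\<close>, and a cycle avoiding \<open>T\<close> has none.\<close>

lemma cycles_avoiding_subset:
  assumes "\<kappa> permutes T"
  shows "{X \<in> cycles_on A \<pi>. X \<inter> T = {}} \<subseteq> {X \<in> cycles_on A (\<kappa> \<circ> \<pi>). X \<inter> T = {}}"
proof
  fix X assume "X \<in> {X \<in> cycles_on A \<pi>. X \<inter> T = {}}"
  then have "X \<in> cycles_on A \<pi>" and dj: "X \<inter> T = {}"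
    by auto
  then obtain x where x: "x \<in> A" "X = orbit \<pi> x"
    unfolding cycles_on_def by blast
  have "orbit (\<kappa> \<circ> \<pi>) x = orbit \<pi> x"
  proof (rule orbit_cong[OF self_in_orbit])
    fix y assume "y \<in> orbit \<pi> x"
    then have "\<pi> y \<notin> T"
      using dj x orbit.step by fastforce
    then show "(\<kappa> \<circ> \<pi>) y = \<pi> y"
      using permutes_not_in[OF assms] by simp
  qed
  then show "X \<in> {X \<in> cycles_on A (\<kappa> \<circ> \<pi>). X \<inter> T = {}}"
    using x dj unfolding cycles_on_def by blast
qed

end

text \<open>The converse inclusion comes from multiplying \<open>\<kappa> \<circ> \<pi>\<close> by
  \<open>inv \<kappa>\<close>, which leads back to \<open>\<pi>\<close>.\<close>

lemma cycles_avoiding_eq: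
  assumes "finite A" "\<pi> permutes A" "\<kappa> permutes T" "T \<subseteq> A"
  shows "{X \<in> cycles_on A (\<kappa> \<circ> \<pi>). X \<inter> T = {}} = {X \<in> cycles_on A \<pi>. X \<inter> T = {}}"
proof
  have "inv \<kappa> \<circ> (\<kappa> \<circ> \<pi>) = \<pi>"
    using permutes_inv_o(2)[OF assms(3)] by (simp add: comp_assoc[symmetric])
  moreover have "\<kappa> \<circ> \<pi> permutes A"
    by (rule permutes_compose[OF assms(2) permutes_subset[OF assms(3,4)]])
  ultimately show "{X \<in> cycles_on A (\<kappa> \<circ> \<pi>). X \<inter> T = {}} \<subseteq> {X \<in> cycles_on A \<pi>. X \<inter> T = {}}"
    using cycles_avoiding_subset[OF assms(1) _ permutes_inv[OF assms(3)], of "\<kappa> \<circ> \<pi>"] by simp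
qed (rule cycles_avoiding_subset[OF assms(1-3)])

text \<open>Closure of \<open>P\<close> under sums of three lets a merger of three counted cycles be
  counted again; closure under sums of two would exclude \<open>odd\<close>.\<close>

lemma cycle_count_le_3cycle_comp:
  assumes fin: "finite A" and perm: "\<pi> permutes A"
    and d: "distinct [a, b, c]" and sub: "{a, b, c} \<subseteq> A"
    and P: "\<forall>i j k. P i \<longrightarrow> P j \<longrightarrow> P k \<longrightarrow> P (i + j + k)"
  shows "cycle_count P A \<pi> \<le> cycle_count P A (cycle_of_list [a, b, c] \<circ> \<pi>) + 2"
proof -
  let ?T = "{a, b, c}"
  define \<kappa> where "\<kappa> = cycle_of_list [a, b, c]"
  define \<sigma> where "\<sigma> = \<kappa> \<circ> \<pi>"
  have \<kappa>: "\<kappa> permutes ?T"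
    unfolding \<kappa>_def using cycle_permutes[of "[a, b, c]"] by simp
  have \<sigma>: "\<sigma> permutes A"
    unfolding \<sigma>_def by (intro permutes_compose perm permutes_subset[OF \<kappa> sub])
  have avoid: "{X \<in> cycles_on A \<sigma>. X \<inter> ?T = {}} = {X \<in> cycles_on A \<pi>. X \<inter> ?T = {}}"
    unfolding \<sigma>_def by (rule cycles_avoiding_eq[OF fin perm \<kappa> sub])
  let ?r = "card {X \<in> cycles_on A \<pi>. X \<inter> ?T = {} \<and> P (card X)}"
  have avoid_P: "{X \<in> cycles_on A \<sigma>. X \<inter> ?T = {} \<and> P (card X)} =
      {X \<in> cycles_on A \<pi>. X \<inter> ?T = {} \<and> P (card X)}"
    using avoid by blast
  let ?Q = "{X \<in> orbit \<pi> ` ?T. P (card X)}"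
  have count_\<pi>: "cycle_count P A \<pi> = card ?Q + ?r"
    by (rule cycle_count_split[OF fin perm sub])
  have count_\<sigma>: "cycle_count P A \<sigma> = card {X \<in> orbit \<sigma> ` ?T. P (card X)} + ?r"
    unfolding avoid_P[symmetric] by (rule cycle_count_split[OF fin \<sigma> sub])
  have "cycle_count P A \<pi> \<le> cycle_count P A \<sigma> + 2"
  proof (cases "card ?Q \<le> 2")
    case True
    then show ?thesis
      using count_\<pi> count_\<sigma> by simp
  next
    case False
    have "card (orbit \<pi> ` ?T) \<le> 3"
      using card_image_le[of ?T "orbit \<pi>"] d by simp
    moreover have "card ?Q \<le> card (orbit \<pi> ` ?T)"
      by (rule card_mono) auto
    ultimately have card3: "card (orbit \<pi> ` ?T) = 3" and "card ?Q = 3"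
      using False by linarith+
    then have "?Q = orbit \<pi> ` ?T"
      by (intro card_subset_eq) auto
    then have P_orbits: "P (card (orbit \<pi> a))" "P (card (orbit \<pi> b))" "P (card (orbit \<pi> c))"
      by auto
    have "inj_on (orbit \<pi>) ?T"
      using card3 d by (intro eq_card_imp_inj_on) auto
    then have ne: "orbit \<pi> a \<noteq> orbit \<pi> b" "orbit \<pi> a \<noteq> orbit \<pi> c" "orbit \<pi> b \<noteq> orbit \<pi> c"
      using d by (auto simp: inj_on_def)
    have dj: "orbit \<pi> x \<inter> orbit \<pi> y = {}" if "orbit \<pi> x \<noteq> orbit \<pi> y" for x y
      using orbit_eq[OF fin perm] that by blast
    \<comment> \<open>As \<open>a\<close>, \<open>b\<close>, \<open>c\<close> lie in distinct cycles
      of \<open>\<pi>\<close>, the cycle of \<open>x\<close> meets \<open>?T\<close> only in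
      \<open>x\<close>, and \<open>\<kappa>\<close> fixes its other points.\<close>
    have next_in: "\<kappa> x \<in> orbit \<sigma> x" if "x \<in> ?T" for x
      unfolding \<sigma>_def
    proof (rule orbit_comp_fixing[OF self_in_orbit[OF fin perm]])
      fix y assume y: "y \<in> orbit \<pi> x" "y \<noteq> x"
      then have "y \<notin> ?T"
        using orbit_eq[OF fin perm y(1)] ne that by auto
      then show "\<kappa> y = y"
        by (rule permutes_not_in[OF \<kappa>])
    qed
    have "\<kappa> a = b" "\<kappa> b = c"
      using d by (auto simp: \<kappa>_def)
    then have "orbit \<sigma> b = orbit \<sigma> a" "orbit \<sigma> c = orbit \<sigma> b"
      using next_in orbit_eq[OF fin \<sigma>] by (metis insertCI)+
    then have merged: "orbit \<sigma> ` ?T = {orbit \<sigma> a}"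
      by simp
    \<comment> \<open>Both unions are the complement in \<open>A\<close> of the same untouched
      cycles.\<close>
    have "\<Union>(orbit \<sigma> ` ?T) = \<Union>(orbit \<pi> ` ?T)"
      unfolding Union_cycles_meeting[OF fin \<sigma> sub] Union_cycles_meeting[OF fin perm sub] avoid ..
    then have "orbit \<sigma> a = orbit \<pi> a \<union> orbit \<pi> b \<union> orbit \<pi> c"
      unfolding merged by auto
    moreover have "finite (orbit \<pi> x)" for x
      by (rule finite_orbit[OF self_in_orbit[OF fin perm]])
    ultimately have "card (orbit \<sigma> a) = card (orbit \<pi> a) + card (orbit \<pi> b) + card (orbit \<pi> c)"
      using dj ne by (simp add: card_Un_disjoint Int_Un_distrib2)
    then have "P (card (orbit \<sigma> a))"
      using P P_orbits by simp
    \<comment> \<open>Three counted cycles are replaced by one, a loss of exactly 2.\<close>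
    then have "{X \<in> orbit \<sigma> ` ?T. P (card X)} = {orbit \<sigma> a}"
      unfolding merged by auto
    then show ?thesis
      using count_\<pi> count_\<sigma> \<open>card ?Q = 3\<close> by simp
  qed
  then show ?thesis
    unfolding \<sigma>_def \<kappa>_def .
qed

lemma cycle_count_3cycle_comp_diff:
  assumes fin: "finite A" and perm: "\<pi> permutes A"
    and d: "distinct [a, b, c]" and sub: "{a, b, c} \<subseteq> A"
    and P: "\<forall>i j k. P i \<longrightarrow> P j \<longrightarrow> P k \<longrightarrow> P (i + j + k)"
  shows "\<bar>int (cycle_count P A (cycle_of_list [a, b, c] \<circ> \<pi>)) - int (cycle_count P A \<pi>)\<bar> \<le> 2"
proof -
  let ?\<sigma> = "cycle_of_list [a, b, c] \<circ> \<pi>"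
  have \<sigma>: "?\<sigma> permutes A"
    using sub by (intro permutes_compose perm cycle_of_list_permutes_superset) simp
  have "cycle_of_list [c, b, a] \<circ> cycle_of_list [a, b, c] = id"
    using cycle_of_list_rev_comp[of "[a, b, c]"] by (simp only: rev.simps append.simps)
  then have "cycle_of_list [c, b, a] \<circ> ?\<sigma> = \<pi>"
    by (simp only: comp_assoc[symmetric] id_comp)
  moreover have "distinct [c, b, a]" "{c, b, a} \<subseteq> A"
    using d sub by auto
  from cycle_count_le_3cycle_comp[OF fin \<sigma> this P]
  have "cycle_count P A ?\<sigma> \<le> cycle_count P A (cycle_of_list [c, b, a] \<circ> ?\<sigma>) + 2"
    by simp
  moreover have "cycle_count P A \<pi> \<le> cycle_count P A ?\<sigma> + 2"
    by (rule cycle_count_le_3cycle_comp[OF fin perm d sub P])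
  ultimately show ?thesis
    by simp
qed

section \<open>The bound along a sorting sequence\<close>

lemma cycle_count_sorting_bound:
  assumes P: "\<forall>i j k. P i \<longrightarrow> P j \<longrightarrow> P k \<longrightarrow> P (i + j + k)"
    and "(transposition_action ^^ k) s (identity_seq n)"
    and "distinct s" "set s = {1..n}" "\<gamma> permutes {0..n}"
  shows "\<bar>int (cycle_count P {0..n} (p_t n \<circ> sbar s \<circ> \<gamma>)) - int (cycle_count P {0..n} \<gamma>)\<bar> \<le> 2 * int k"
  using assms(2-)
\<comment> \<open>\<open>\<gamma>\<close> must vary, since each action multiplies it by a
  3-cycle.\<close>
proof (induction k arbitrary: s \<gamma>)
  case 0
  then show ?case
    by (simp add: p_t_comp_sbar_identity_seq)
next
  case (Suc k)
  obtain t where act: "transposition_action s t"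
    and rest: "(transposition_action ^^ k) t (identity_seq n)"
    using Suc.prems(1) by (meson relpowp_Suc_D2)
  have t: "distinct t" "set t = {1..n}"
    using transposition_action_mset[OF act] Suc.prems(2,3)
    by (metis mset_eq_imp_distinct_iff, metis mset_eq_setD)
  have "distinct (0 # s)"
    using Suc.prems(2,3) by simp
  then obtain a b c where d: "distinct [a, b, c]" and "{a, b, c} \<subseteq> insert 0 (set s)"
    and s: "sbar s = sbar t \<circ> cycle_of_list [a, b, c]"
    using sbar_transposition_action[OF act] by blast
  then have sub: "{a, b, c} \<subseteq> {0..n}"
    using Suc.prems(3) by auto
  let ?\<gamma> = "cycle_of_list [a, b, c] \<circ> \<gamma>"
  have "?\<gamma> permutes {0..n}"
    using sub by (intro permutes_compose Suc.prems(4) cycle_of_list_permutes_superset) simp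
  \<comment> \<open>By associativity the 3-cycle passes from \<open>sbar s\<close> to
    \<open>\<gamma>\<close>:
    \<open>sbar s \<circ> \<gamma> = sbar t \<circ> ?\<gamma>\<close>.\<close>
  from Suc.IH[OF rest t this] have IH:
     "\<bar>int (cycle_count P {0..n} (p_t n \<circ> sbar s \<circ> \<gamma>)) - int (cycle_count P {0..n} ?\<gamma>)\<bar> \<le> 2 * int k"
    unfolding s by (simp only: comp_assoc)
  have "\<bar>int (cycle_count P {0..n} ?\<gamma>) - int (cycle_count P {0..n} \<gamma>)\<bar> \<le> 2"
    by (rule cycle_count_3cycle_comp_diff[OF finite_atLeastAtMost Suc.prems(4) d sub P])
  with IH show ?case
    by (smt (verit) of_nat_Suc)
qed

theorem theorem4:
  fixes n :: nat and s :: "nat list"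
  assumes "n \<ge> 1"
    and "s \<in> permutations_of_set {1..n}"
  shows "real (td s) \<ge>
    (MAX \<gamma> \<in> {\<gamma>. \<gamma> permutes {0..n}}.
      max \<bar>real (C {0..n} (p_t n \<circ> sbar s \<circ> \<gamma>)) - real (C {0..n} \<gamma>)\<bar>
        (max \<bar>real (C_odd {0..n} (p_t n \<circ> sbar s \<circ> \<gamma>)) - real (C_odd {0..n} \<gamma>)\<bar>
             \<bar>real (C_ev {0..n} (p_t n \<circ> sbar s \<circ> \<gamma>)) - real (C_ev {0..n} \<gamma>)\<bar>) / 2)"
proof -
  have s: "distinct s" "set s = {1..n}"
    using assms(2) by (auto dest: permutations_of_setD)
  have counts: "C = cycle_count (\<lambda>_. True)" "C_odd = cycle_count odd" "C_ev = cycle_count even"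
    by (simp_all add: fun_eq_iff C_def C_odd_def C_ev_def cycle_count_def)
  have bound: "\<bar>real (cycle_count P {0..n} (p_t n \<circ> sbar s \<circ> \<gamma>)) - real (cycle_count P {0..n} \<gamma>)\<bar>
      \<le> 2 * real (td s)"
    if "\<gamma> permutes {0..n}" "\<forall>i j k. P i \<longrightarrow> P j \<longrightarrow> P k \<longrightarrow> P (i + j + k)" for \<gamma> P
    using cycle_count_sorting_bound[OF that(2) td_attained[OF assms(2)] s that(1)] by linarith
  \<comment> \<open>Nonemptiness and finiteness reduce the bound on the maximum to a bound for each
    \<open>\<gamma>\<close>.\<close>
  have "{\<gamma>. \<gamma> permutes {0..n}} \<noteq> {}"
    using permutes_id by blast
  moreover have "finite {\<gamma>. \<gamma> permutes {0..n}}"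
    by (simp add: finite_permutations)
  ultimately show ?thesis
    using bound[of _ "\<lambda>_. True"] bound[of _ odd] bound[of _ even]
    by (simp add: Max_le_iff counts mult.commute)
qed

end
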